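(* Let $G$ be a connected graph on $n$ vertices with chromatic number $\chi=\chi(G)$, fix a proper coloring of $G$ with exactly $\chi$ color classes, and let $\ell_1\ge\ell_2\ge\cdots\ge\ell_\chi\ge 1$ be the sizes of its color classes. Then $$\partial^{L}_i(G)\ge n+\ell_1\qquad\text{for } 1\le i\le \ell_1-1.$$ More generally, let $s_0=0$ and $s_j=\sum_{t=1}^{j}(\ell_t-1)$ for $j\ge 1$, and let $p=|\{j:\ell_j\ge 2\}|$. Then, for every $1\le j\le p$, $$\partial^{L}_i(G)\ge n+\ell_j\qquad\text{whenever } s_{j-1}+1\le i\le s_j .$$
   Context: Graphs are finite, simple and undirected. For a connected graph $G$ with vertices $v_1,\dots,v_n$, let $d_G(u,v)$ be the length of a shortest $u$–$v$ path, $D(G)=(d_G(v_i,v_j))_{i,j}$ the distance matrix, and $\operatorname{Tr}_G(v)=\sum_{u\in V(G)}d_G(u,v)$ the transmission of $v$. The distance Laplacian matrix is $\mathcal{D}^{L}(G)=\operatorname{diag}(\operatorname{Tr}_G(v_1),\dots,\operatorname{Tr}_G(v_n))-D(G)$, a real symmetric positive semidefinite matrix with $\mathcal{D}^{L}(G)\mathbf 1=\mathbf 0$. Its eigenvalues, listed with multiplicity, are ordered $\partial^{L}_1(G)\ge\partial^{L}_2(G)\ge\cdots\ge\partial^{L}_n(G)=0$. A proper coloring is a partition of $V(G)$ into nonempty independent sets (color classes); $\chi(G)$ is the least number of classes. *)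

theory Defs
  imports
    "Graph_Theory.Graph_Theory"
    "Jordan_Normal_Form.Char_Poly"
    "HOL-Library.Multiset"
    "HOL-Library.Disjoint_Sets"
begin

text \<open>A finite simple undirected graph is a digraph satisfying the predicate \<open>graph\<close>: finite,
  loop-free, without parallel arcs, and symmetric, so that every edge is a pair of opposite arcs.\<close>

definition graph_dist :: "('a, 'b) pre_digraph \<Rightarrow> 'a \<Rightarrow> 'a \<Rightarrow> nat" where
  "graph_dist G u v = (LEAST k. \<exists>p. pre_digraph.apath G u p v \<and> length p = k)"

definition transmission :: "('a, 'b) pre_digraph \<Rightarrow> 'a \<Rightarrow> nat" where
  "transmission G v = (\<Sum>u \<in> verts G. graph_dist G u v)"

text \<open>The list \<open>vs\<close> fixes the numbering of the vertices; it is meant to be distinct with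
  \<open>set vs = verts G\<close>.\<close>

definition distance_matrix :: "('a, 'b) pre_digraph \<Rightarrow> 'a list \<Rightarrow> real mat" where
  "distance_matrix G vs =
     mat (length vs) (length vs) (\<lambda>(i, j). real (graph_dist G (vs ! i) (vs ! j)))"

definition distance_laplacian :: "('a, 'b) pre_digraph \<Rightarrow> 'a list \<Rightarrow> real mat" where
  "distance_laplacian G vs =
     mat_diag (length vs) (\<lambda>i. real (transmission G (vs ! i))) - distance_matrix G vs"

text \<open>The \<open>i\<close>-th largest element of a multiset, counted with multiplicity and from 1; only
  meaningful for \<open>1 \<le> i \<le> size M\<close>.\<close>

definition nth_largest :: "'a :: linorder multiset \<Rightarrow> nat \<Rightarrow> 'a" where
  "nth_largest M i = rev (sorted_list_of_multiset M) ! (i - 1)"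

text \<open>The real roots of the characteristic polynomial are all the eigenvalues, with multiplicity,
  since the matrix is real symmetric when \<open>G\<close> is an undirected graph.\<close>

definition dl_eigenvalue :: "('a, 'b) pre_digraph \<Rightarrow> 'a list \<Rightarrow> nat \<Rightarrow> real" where
  "dl_eigenvalue G vs i = nth_largest (proots (char_poly (distance_laplacian G vs))) i"

definition independent_set :: "('a, 'b) pre_digraph \<Rightarrow> 'a set \<Rightarrow> bool" where
  "independent_set G A \<longleftrightarrow> A \<subseteq> verts G \<and> (\<forall>u \<in> A. \<forall>v \<in> A. (u, v) \<notin> arcs_ends G)"

definition proper_coloring :: "('a, 'b) pre_digraph \<Rightarrow> 'a set set \<Rightarrow> bool" where
  "proper_coloring G C \<longleftrightarrow> partition_on (verts G) C \<and> (\<forall>A \<in> C. independent_set G A)"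

definition chromatic_number :: "('a, 'b) pre_digraph \<Rightarrow> nat" where
  "chromatic_number G = (LEAST k. \<exists>C. proper_coloring G C \<and> card C = k)"

definition class_size :: "'a set set \<Rightarrow> nat \<Rightarrow> nat" where
  "class_size C j = nth_largest (image_mset card (mset_set C)) j"

end

theory Submission
  imports Defs
begin

text \<open>
  The distance Laplacian \<open>L\<close> has the quadratic form
  \<open>x \<bullet> L x = 1/2 (\<Sum>u v. d(u,v) (x u - x v)\<^sup>2)\<close>, so it grows with the distances. In a properly
  coloured connected graph, distinct vertices are at distance at least 1, and at least 2 if they
  share a colour. Hence \<open>L\<close> dominates the distance Laplacian of the complete multipartite graph on
  the colour classes. There every vector that is supported on a class of size \<open>m\<close> and has
  sum 0 is an eigenvector for \<open>n + m\<close>.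

  Take the \<open>j\<close> largest classes, of sizes \<open>l\<^sub>1 \<ge> \<dots> \<ge> l\<^sub>j\<close>, and the space \<open>W\<close> of all vectors that
  vanish outside these classes and have sum 0 on each of them. Its codimension is at most
  \<open>n - (l\<^sub>1 + \<dots> + l\<^sub>j) + j = n - s\<^sub>j\<close>, and \<open>x \<bullet> L x \<ge> (n + l\<^sub>j) (x \<bullet> x)\<close> on it
  (\<open>weighted_square_diff_ge\<close>). By one half of the Courant-Fischer theorem
  (\<open>nth_largest_eigenvalue_ge\<close>), the \<open>s\<^sub>j\<close> largest eigenvalues are then at least \<open>n + l\<^sub>j\<close>. As
  \<open>s\<^sub>1 = l\<^sub>1 - 1\<close>, both parts of the theorem are instances of this bound.

  Courant-Fischer needs an orthonormal basis of eigenvectors of a real symmetric matrix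
  (\<open>real_symmetric_diagonalization\<close>), which is built by splitting off one eigenvector at a time with
  a Householder reflection.
\<close>

section \<open>Orthogonal diagonalization of real symmetric matrices\<close>

lemma scalar_prod_self_pos:
  fixes v :: "real vec"
  assumes v: "v \<in> carrier_vec n" "v \<noteq> 0\<^sub>v n"
  shows "0 < v \<bullet> v"
proof -
  obtain k where k: "k < n" "v $ k \<noteq> 0"
    using v by (metis eq_vecI carrier_vecD index_zero_vec)
  then have "0 < (\<Sum>i<n. v $ i * v $ i)"
    by (intro sum_pos2[of _ k]) (auto simp: zero_less_mult_iff)
  then show ?thesis using v by (simp add: scalar_prod_def lessThan_atLeast0)
qed

text \<open>The characteristic polynomial has a complex root \<open>z\<close>. If \<open>a + \<i> b\<close> is an eigenvector for \<open>z\<close>, with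
  \<open>a\<close> and \<open>b\<close> real, then comparing the two sides of \<open>b \<bullet> A a = A b \<bullet> a\<close> gives
  \<open>Im z (a \<bullet> a + b \<bullet> b) = 0\<close>. So \<open>z\<close> is real, and \<open>a\<close> or \<open>b\<close> is a real eigenvector.\<close>

lemma real_symmetric_eigenvector:
  fixes A :: "real mat"
  assumes A: "A \<in> carrier_mat n n" and sym: "transpose_mat A = A" and n: "n > 0"
  obtains v e where "v \<in> carrier_vec n" "v \<noteq> 0\<^sub>v n" "A *\<^sub>v v = e \<cdot>\<^sub>v v"
proof -
  let ?c = "of_real :: real \<Rightarrow> complex"
  let ?A = "map_mat ?c A"
  have cA: "?A \<in> carrier_mat n n" using A by auto
  obtain as where as: "char_poly ?A = (\<Prod> a \<leftarrow> as. [:- a, 1:])" "length as = n"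
    using char_poly_factorized[OF cA] by auto
  from as n obtain z where "z \<in> set as" by (cases as) auto
  then have "poly (char_poly ?A) z = 0"
    unfolding as(1) by (simp add: linear_poly_root)
  then have "eigenvalue ?A z" using eigenvalue_root_char_poly[OF cA] by simp
  then obtain w where w: "w \<in> carrier_vec n" "w \<noteq> 0\<^sub>v n" and ev: "?A *\<^sub>v w = z \<cdot>\<^sub>v w"
    unfolding eigenvalue_def eigenvector_def using cA by auto
  define a where "a = map_vec Re w"
  define b where "b = map_vec Im w"
  have a: "a \<in> carrier_vec n" and b: "b \<in> carrier_vec n" using w unfolding a_def b_def by auto
  have ent: "(\<Sum>k<n. of_real (A $$ (i,k)) * w $ k) = z * w $ i" if "i < n" for i
    using arg_cong[OF ev, of "\<lambda>x. x $ i"] that w(1) A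
    by (simp add: scalar_prod_def lessThan_atLeast0)
  have Aa: "A *\<^sub>v a = Re z \<cdot>\<^sub>v a - Im z \<cdot>\<^sub>v b"
  proof (rule eq_vecI)
    fix i assume "i < dim_vec (Re z \<cdot>\<^sub>v a - Im z \<cdot>\<^sub>v b)"
    then have i: "i < n" using b by simp
    show "(A *\<^sub>v a) $ i = (Re z \<cdot>\<^sub>v a - Im z \<cdot>\<^sub>v b) $ i"
      using arg_cong[OF ent[OF i], of Re] i w(1) A
      by (simp add: scalar_prod_def lessThan_atLeast0 a_def b_def)
  qed (use A b in auto)
  have Ab: "A *\<^sub>v b = Re z \<cdot>\<^sub>v b + Im z \<cdot>\<^sub>v a"
  proof (rule eq_vecI)
    fix i assume "i < dim_vec (Re z \<cdot>\<^sub>v b + Im z \<cdot>\<^sub>v a)"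
    then have i: "i < n" using a by simp
    show "(A *\<^sub>v b) $ i = (Re z \<cdot>\<^sub>v b + Im z \<cdot>\<^sub>v a) $ i"
      using arg_cong[OF ent[OF i], of Im] i w(1) A
      by (simp add: scalar_prod_def lessThan_atLeast0 a_def b_def)
  qed (use A a in auto)
  have "a \<noteq> 0\<^sub>v n \<or> b \<noteq> 0\<^sub>v n"
  proof (rule ccontr)
    assume "\<not> ?thesis"
    then have z: "map_vec Re w = 0\<^sub>v n" "map_vec Im w = 0\<^sub>v n" by (auto simp: a_def b_def)
    have "w $ i = 0" if "i < n" for i
      using arg_cong[OF z(1), of "\<lambda>x. x $ i"] arg_cong[OF z(2), of "\<lambda>x. x $ i"] that w(1)
      by (simp add: complex_eq_iff)
    then have "w = 0\<^sub>v n" using w(1) by (intro eq_vecI) auto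
    with w(2) show False ..
  qed
  moreover have "0 \<le> a \<bullet> a" "0 \<le> b \<bullet> b" by (auto simp: scalar_prod_def intro: sum_nonneg)
  ultimately have nz: "a \<bullet> a + b \<bullet> b \<noteq> 0"
    using scalar_prod_self_pos[OF a] scalar_prod_self_pos[OF b] by force
  have "b \<bullet> (A *\<^sub>v a) = (A *\<^sub>v b) \<bullet> a"
    using transpose_vec_mult_scalar[OF A a b] sym by simp
  then have "Im z * (a \<bullet> a + b \<bullet> b) = 0"
    unfolding Aa Ab using a b
    by (simp add: scalar_prod_minus_distrib[of _ n] add_scalar_prod_distrib[of _ n]
        comm_scalar_prod[of b n a] algebra_simps)
  then have "Im z = 0" using nz by simp
  then have "A *\<^sub>v a = Re z \<cdot>\<^sub>v a" "A *\<^sub>v b = Re z \<cdot>\<^sub>v b"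
    unfolding Aa Ab using a b by (auto intro!: eq_vecI)
  moreover have "a \<noteq> 0\<^sub>v n \<or> b \<noteq> 0\<^sub>v n" using nz by auto
  ultimately show ?thesis using that a b by blast
qed

text \<open>\<open>H\<close> is the reflection in the hyperplane that bisects \<open>v\<close> and the multiple of the first unit vector of
  the same length. If \<open>v\<close> already is that multiple, then \<open>w = 0\<close> and \<open>q = 0\<close> below, and \<open>H\<close> is the
  identity because division by 0 yields 0.\<close>

lemma householder:
  fixes v :: "real vec"
  assumes v: "v \<in> carrier_vec n"
  obtains H where "H \<in> carrier_mat n n" "transpose_mat H = H" "H * H = 1\<^sub>m n"
    "H *\<^sub>v v = sqrt (v \<bullet> v) \<cdot>\<^sub>v unit_vec n 0"
proof -
  define w where "w = v - sqrt (v \<bullet> v) \<cdot>\<^sub>v unit_vec n 0"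
  define q where "q = (\<Sum>k<n. w $ k * w $ k)"
  have w: "w \<in> carrier_vec n" using v unfolding w_def by simp
  have q0: "w $ i = 0" if "q = 0" "i < n" for i
    using that unfolding q_def by (subst (asm) sum_nonneg_eq_0_iff) auto
  define H where "H = mat n n (\<lambda>(i, j). (if i = j then 1 else 0) - 2 * w $ i * w $ j / q)"
  have H: "H \<in> carrier_mat n n" unfolding H_def by simp
  have HH: "H * H = 1\<^sub>m n"
  proof (rule eq_matI)
    fix i j assume "i < dim_row (1\<^sub>m n :: real mat)" "j < dim_col (1\<^sub>m n :: real mat)"
    then have ij: "i < n" "j < n" by auto
    define c where "c = 4 * w $ i * w $ j / q\<^sup>2"
    have "(H * H) $$ (i, j) = (\<Sum>k<n. ((if i = k then 1 else 0) - 2 * w $ i * w $ k / q) *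
        ((if k = j then 1 else 0) - 2 * w $ k * w $ j / q))"
      using ij by (simp add: H_def scalar_prod_def lessThan_atLeast0)
    also have "\<dots> = (\<Sum>k<n. (if k = i then (if i = j then 1 else 0) else 0)
        - (if k = i then 2 * w $ i * w $ j / q else 0)
        - (if k = j then 2 * w $ i * w $ j / q else 0)
        + c * (w $ k * w $ k))"
      by (intro sum.cong) (auto simp: c_def algebra_simps power2_eq_square)
    also have "\<dots> = (if i = j then 1 else 0) - 4 * w $ i * w $ j / q + c * q"
      using ij by (simp add: sum.distrib sum_subtractf sum_distrib_left[symmetric] flip: q_def)
    also have "\<dots> = (if i = j then 1 else 0)" by (simp add: c_def power2_eq_square)
    finally show "(H * H) $$ (i, j) = 1\<^sub>m n $$ (i, j)" using ij by simp
  qed (auto simp: H_def)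
  have "H *\<^sub>v v = sqrt (v \<bullet> v) \<cdot>\<^sub>v unit_vec n 0"
  proof (rule eq_vecI)
    fix i assume "i < dim_vec (sqrt (v \<bullet> v) \<cdot>\<^sub>v unit_vec n 0)"
    then have i: "i < n" by simp
    define c where "c = sqrt (v \<bullet> v)"
    have c2: "c * c = (\<Sum>k<n. v $ k * v $ k)"
      unfolding c_def using v by (simp add: scalar_prod_def lessThan_atLeast0 sum_nonneg)
    have wk: "w $ k = v $ k - (if k = 0 then c else 0)" if "k < n" for k
      using that v by (simp add: w_def c_def)
    \<comment> \<open>The next two facts give \<open>q = 2 (w \<bullet> v)\<close>; this is why the reflection sends \<open>v\<close> to \<open>v - w\<close>.\<close>
    have wv: "(\<Sum>k<n. w $ k * v $ k) = c * c - c * v $ 0"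
    proof -
      have "(\<Sum>k<n. w $ k * v $ k) = (\<Sum>k<n. v $ k * v $ k - (if k = 0 then c * v $ 0 else 0))"
        by (intro sum.cong) (auto simp: wk algebra_simps)
      then show ?thesis using i by (simp add: sum_subtractf c2)
    qed
    have qq: "q = 2 * (c * c - c * v $ 0)"
    proof -
      have "q = (\<Sum>k<n. v $ k * v $ k - (if k = 0 then 2 * c * v $ 0 else 0) + (if k = 0 then c * c else 0))"
        unfolding q_def by (intro sum.cong) (auto simp: wk algebra_simps)
      then show ?thesis using i by (simp add: sum_subtractf sum.distrib c2)
    qed
    have "(H *\<^sub>v v) $ i = (\<Sum>k<n. ((if i = k then 1 else 0) - 2 * w $ i * w $ k / q) * v $ k)"
      using i v by (simp add: H_def scalar_prod_def lessThan_atLeast0)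
    also have "\<dots> = (\<Sum>k<n. (if k = i then v $ i else 0) - 2 * w $ i / q * (w $ k * v $ k))"
      by (intro sum.cong) (auto simp: algebra_simps)
    also have "\<dots> = v $ i - 2 * w $ i / q * (\<Sum>k<n. w $ k * v $ k)"
      unfolding sum_subtractf sum_distrib_left using i by simp
    also have "\<dots> = v $ i - 2 * w $ i / q * (c * c - c * v $ 0)"
      unfolding wv ..
    also have "\<dots> = v $ i - w $ i"
    proof (cases "q = 0")
      case False
      have "w $ i / q * (2 * (c * c - c * v $ 0)) = w $ i" unfolding qq[symmetric] using False by simp
      moreover have "2 * w $ i / q * (c * c - c * v $ 0) = w $ i / q * (2 * (c * c - c * v $ 0))" by simp
      ultimately show ?thesis by linarith
    qed (use q0[OF _ i] in simp)
    finally show "(H *\<^sub>v v) $ i = (sqrt (v \<bullet> v) \<cdot>\<^sub>v unit_vec n 0) $ i"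
      using i wk[OF i] by (simp add: c_def)
  qed (simp add: H_def)
  moreover have "transpose_mat H = H" by (rule eq_matI) (auto simp: H_def)
  ultimately show ?thesis using that H HH by blast
qed

lemma block_diag_mult:
  fixes A :: "'a :: comm_semiring_1 mat"
  assumes "A \<in> carrier_mat m m" "A' \<in> carrier_mat m m" "D \<in> carrier_mat n n" "D' \<in> carrier_mat n n"
  shows "four_block_mat A (0\<^sub>m m n) (0\<^sub>m n m) D * four_block_mat A' (0\<^sub>m m n) (0\<^sub>m n m) D' =
    four_block_mat (A * A') (0\<^sub>m m n) (0\<^sub>m n m) (D * D')"
  unfolding mult_four_block_mat[OF assms(1) zero_carrier_mat zero_carrier_mat assms(3)
      assms(2) zero_carrier_mat zero_carrier_mat assms(4)]
  using assms by (intro cong_four_block_mat) auto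

text \<open>Induction on the dimension: a reflection \<open>H\<close> moves an eigenvector to the first axis. By symmetry,
  the first row and the first column of \<open>H A H\<close> then vanish off the diagonal, so that the induction
  hypothesis applies to the remaining block.\<close>

lemma real_symmetric_diagonalization:
  fixes A :: "real mat"
  assumes "A \<in> carrier_mat n n" "transpose_mat A = A"
  shows "\<exists>U e. U \<in> carrier_mat n n \<and> transpose_mat U * U = 1\<^sub>m n \<and>
    A = U * mat_diag n e * transpose_mat U"
  using assms
proof (induction n arbitrary: A)
  case 0
  then show ?case by (intro exI[of _ "1\<^sub>m 0"] exI[of _ "\<lambda>_. 0"]) auto
next
  case (Suc n)
  note A = Suc.prems(1) and sym = Suc.prems(2)
  obtain v e where v: "v \<in> carrier_vec (Suc n)" "v \<noteq> 0\<^sub>v (Suc n)" and ev: "A *\<^sub>v v = e \<cdot>\<^sub>v v"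
    using real_symmetric_eigenvector[OF A sym] by auto
  define c where "c = sqrt (v \<bullet> v)"
  have c: "c \<noteq> 0" using scalar_prod_self_pos[OF v] by (simp add: c_def)
  obtain H where H: "H \<in> carrier_mat (Suc n) (Suc n)" "transpose_mat H = H" "H * H = 1\<^sub>m (Suc n)"
    and Hv: "H *\<^sub>v v = c \<cdot>\<^sub>v unit_vec (Suc n) 0"
    using householder[OF v(1)] unfolding c_def by blast
  define M where "M = H * A * H"
  have M: "M \<in> carrier_mat (Suc n) (Suc n)" using H A by (simp add: M_def)
  have symM: "transpose_mat M = M"
    unfolding M_def using H A sym
    by (simp add: transpose_mult[of _ "Suc n" "Suc n" _ "Suc n"])
  have Hu: "H *\<^sub>v (c \<cdot>\<^sub>v unit_vec (Suc n) 0) = v"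
    using assoc_mult_mat_vec[OF H(1) H(1) v(1)] H(3) v(1) by (simp add: Hv)
  have "M *\<^sub>v (c \<cdot>\<^sub>v unit_vec (Suc n) 0) = H *\<^sub>v (A *\<^sub>v v)"
    unfolding M_def using H A v Hu
    by (simp add: assoc_mult_mat_vec[of _ "Suc n" "Suc n" _ "Suc n"])
  also have "\<dots> = e \<cdot>\<^sub>v (c \<cdot>\<^sub>v unit_vec (Suc n) 0)"
    unfolding ev using H v Hv by (simp add: mult_mat_vec)
  finally have Mu: "c \<cdot>\<^sub>v (M *\<^sub>v unit_vec (Suc n) 0) = e \<cdot>\<^sub>v (c \<cdot>\<^sub>v unit_vec (Suc n) 0)"
    using M by (simp add: mult_mat_vec)
  have M0: "M $$ (i, 0) = (if i = 0 then e else 0)" if "i < Suc n" for i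
    using arg_cong[OF Mu, of "\<lambda>x. x $ i"] c that M by (auto split: if_splits)
  have M0': "M $$ (0, i) = (if i = 0 then e else 0)" if "i < Suc n" for i
    using M0[OF that] arg_cong[OF symM, of "\<lambda>x. x $$ (0, i)"] that M by auto
  define B where "B = mat n n (\<lambda>(i, j). M $$ (Suc i, Suc j))"
  have B: "B \<in> carrier_mat n n" by (simp add: B_def)
  have "transpose_mat B = B"
  proof (rule eq_matI)
    fix i j assume "i < dim_row B" "j < dim_col B"
    then show "transpose_mat B $$ (i, j) = B $$ (i, j)"
      using arg_cong[OF symM, of "\<lambda>x. x $$ (Suc i, Suc j)"] M by (simp add: B_def)
  qed (auto simp: B_def)
  from Suc.IH[OF B this] obtain V f where V: "V \<in> carrier_mat n n" "transpose_mat V * V = 1\<^sub>m n"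
    and BV: "B = V * mat_diag n f * transpose_mat V" by auto
  have Vt: "transpose_mat V \<in> carrier_mat n n" using V by simp
  define F where "F = four_block_mat (1\<^sub>m 1) (0\<^sub>m 1 n) (0\<^sub>m n 1) V"
  have F: "F \<in> carrier_mat (Suc n) (Suc n)" using V unfolding F_def
    by (metis One_nat_def four_block_carrier_mat one_carrier_mat plus_1_eq_Suc)
  have Ft: "transpose_mat F = four_block_mat (1\<^sub>m 1) (0\<^sub>m 1 n) (0\<^sub>m n 1) (transpose_mat V)"
    unfolding F_def transpose_four_block_mat[OF one_carrier_mat zero_carrier_mat zero_carrier_mat V(1)]
    by simp
  define g where "g = case_nat e f"
  have D: "mat_diag (Suc n) g = four_block_mat (mat_diag 1 (\<lambda>_. e)) (0\<^sub>m 1 n) (0\<^sub>m n 1) (mat_diag n f)"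
    by (rule eq_matI) (auto simp: mat_diag_def g_def split: nat.splits)
  have Mb: "M = four_block_mat (mat_diag 1 (\<lambda>_. e)) (0\<^sub>m 1 n) (0\<^sub>m n 1) B"
    by (rule eq_matI) (use M M0 M0' in \<open>auto simp: mat_diag_def B_def\<close>)
  have FF: "transpose_mat F * F = 1\<^sub>m (Suc n)"
    unfolding Ft unfolding F_def using block_diag_mult[OF one_carrier_mat one_carrier_mat Vt V(1)]
    by (simp add: V(2))
  have MF: "M = F * mat_diag (Suc n) g * transpose_mat F"
  proof -
    have "F * mat_diag (Suc n) g =
        four_block_mat (1\<^sub>m 1 * mat_diag 1 (\<lambda>_. e)) (0\<^sub>m 1 n) (0\<^sub>m n 1) (V * mat_diag n f)"
      unfolding D F_def by (rule block_diag_mult) (use V in auto)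
    also have "\<dots> * transpose_mat F = four_block_mat (1\<^sub>m 1 * mat_diag 1 (\<lambda>_. e) * 1\<^sub>m 1)
        (0\<^sub>m 1 n) (0\<^sub>m n 1) (V * mat_diag n f * transpose_mat V)"
      unfolding Ft using V by (intro block_diag_mult mult_carrier_mat one_carrier_mat mat_diag_dim) auto
    also have "\<dots> = M"
      unfolding Mb BV left_mult_one_mat[OF mat_diag_dim] right_mult_one_mat[OF mat_diag_dim] ..
    finally show ?thesis by simp
  qed
  define U where "U = H * F"
  have U: "U \<in> carrier_mat (Suc n) (Suc n)" using H F by (simp add: U_def)
  have Ut: "transpose_mat U = transpose_mat F * H"
    unfolding U_def using H F by (simp add: transpose_mult[of _ "Suc n" "Suc n" _ "Suc n"])
  note assoc = assoc_mult_mat[of _ "Suc n" "Suc n" _ "Suc n" _ "Suc n"]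
  have "transpose_mat U * U = transpose_mat F * (H * H) * F"
    unfolding Ut unfolding U_def using H(1) F by (simp add: assoc)
  also have "\<dots> = 1\<^sub>m (Suc n)" using H F FF by simp
  finally have UU: "transpose_mat U * U = 1\<^sub>m (Suc n)" .
  have "A = (H * H) * A * (H * H)" using H A by simp
  also have "\<dots> = H * M * H" unfolding M_def using H(1) A by (simp add: assoc)
  also have "\<dots> = U * mat_diag (Suc n) g * transpose_mat U"
    unfolding Ut unfolding MF U_def using H(1) F
    by (simp add: assoc mult_carrier_mat[of _ "Suc n" "Suc n" _ "Suc n"])
  finally show ?case using U UU by blast
qed

section \<open>A lower bound for the largest eigenvalues\<close>

text \<open>Padding the system with zero rows makes it square and singular.\<close>

lemma homogeneous_system_nontrivial_solution:
  fixes cs :: "'a :: field vec list"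
  assumes cs: "set cs \<subseteq> carrier_vec n" and len: "length cs < n"
  obtains x where "x \<in> carrier_vec n" "x \<noteq> 0\<^sub>v n" "\<And>c. c \<in> set cs \<Longrightarrow> c \<bullet> x = 0"
proof -
  define R where "R = mat_of_rows n (cs @ replicate (n - length cs) (0\<^sub>v n))"
  have R: "R \<in> carrier_mat n n" using len by (auto simp: R_def mat_of_rows_def)
  have row: "row R i = (cs @ replicate (n - length cs) (0\<^sub>v n)) ! i" if "i < n" for i
    unfolding R_def using that cs len by (intro mat_of_rows_row) (auto simp: nth_append)
  \<comment> \<open>The last row of \<open>R\<close> is zero, so the last unit vector is in the kernel of the transpose.\<close>
  have "unit_vec n (n - 1) \<noteq> (0\<^sub>v n :: 'a vec)"
    using len by (simp add: unit_vec_nonzero)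
  moreover have "transpose_mat R *\<^sub>v unit_vec n (n - 1) = 0\<^sub>v n"
  proof (rule eq_vecI)
    fix i assume "i < dim_vec (0\<^sub>v n :: 'a vec)"
    then have i: "i < n" by simp
    have last: "\<not> n - 1 < length cs" "n - 1 < n" using len by linarith+
    then have "row R (n - 1) = 0\<^sub>v n" using row[of "n - 1"] len by (simp add: nth_append)
    then have "row R (n - 1) $ i = 0" using i by simp
    then have "R $$ (n - 1, i) = 0" using R i last(2) by simp
    moreover have "(transpose_mat R *\<^sub>v unit_vec n (n - 1)) $ i = R $$ (n - 1, i)"
      using R i last(2) by simp
    ultimately show "(transpose_mat R *\<^sub>v unit_vec n (n - 1)) $ i = 0\<^sub>v n $ i" using i by simp
  qed (use R in auto)
  ultimately have "det (transpose_mat R) = 0"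
    using det_0_iff_vec_prod_zero_field[of "transpose_mat R" n] R by (metis transpose_carrier_mat unit_vec_carrier)
  then have "det R = 0" using det_transpose[OF R] by simp
  then obtain x where x: "x \<in> carrier_vec n" "x \<noteq> 0\<^sub>v n" "R *\<^sub>v x = 0\<^sub>v n"
    using det_0_iff_vec_prod_zero_field[OF R] by auto
  have "c \<bullet> x = 0" if c: "c \<in> set cs" for c
  proof -
    from c obtain i where i: "i < length cs" "c = cs ! i" by (auto simp: in_set_conv_nth)
    then have "c = row R i" using row[of i] len by (simp add: nth_append)
    then show ?thesis using arg_cong[OF x(3), of "\<lambda>y. y $ i"] i len R by simp
  qed
  with x show ?thesis using that by blast
qed

lemma proots_prod_linear_factors:
  fixes as :: "'a :: idom list"
  shows "proots (\<Prod> a \<leftarrow> as. [:- a, 1:]) = mset as"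
proof (induction as)
  case (Cons a as)
  have "(\<Prod> a \<leftarrow> as. [:- a, 1:]) \<noteq> 0" by (auto simp: prod_list_zero_iff)
  then have "proots ([:- a, 1:] * (\<Prod> a \<leftarrow> as. [:- a, 1:])) = {#a#} + mset as"
    by (subst proots_mult) (auto simp: Cons)
  then show ?case by simp
qed simp

lemma proots_char_poly_mat_diag:
  fixes e :: "nat \<Rightarrow> 'a :: field"
  shows "proots (char_poly (mat_diag n e)) = mset (map e [0..<n])"
proof -
  have "char_poly (mat_diag n e) = (\<Prod> a \<leftarrow> diag_mat (mat_diag n e). [:- a, 1:])"
    by (rule char_poly_upper_triangular[of _ n]) (auto simp: mat_diag_def)
  also have "diag_mat (mat_diag n e) = map e [0..<n]"
    by (simp add: diag_mat_def mat_diag_def)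
  also have "proots (\<Prod> a \<leftarrow> map e [0..<n]. [:- a, 1:]) = mset (map e [0..<n])"
    by (rule proots_prod_linear_factors)
  finally show ?thesis .
qed

lemma le_nth_largest:
  assumes "1 \<le> i" "i \<le> size (filter_mset (\<lambda>x. c \<le> x) M)"
  shows "c \<le> nth_largest M i"
proof (rule ccontr)
  define xs where "xs = rev (sorted_list_of_multiset M)"
  have M: "mset xs = M" by (simp add: xs_def)
  have dec: "sorted_wrt (\<ge>) xs" by (simp add: xs_def sorted_wrt_rev)
  assume "\<not> c \<le> nth_largest M i"
  then have small: "xs ! (i - 1) < c" by (simp add: nth_largest_def xs_def)
  have "{k. k < length xs \<and> c \<le> xs ! k} \<subseteq> {..<i - 1}"
  proof
    fix k assume k: "k \<in> {k. k < length xs \<and> c \<le> xs ! k}"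
    show "k \<in> {..<i - 1}"
    proof (rule ccontr)
      assume "k \<notin> {..<i - 1}"
      then have "xs ! k \<le> xs ! (i - 1)"
        using k sorted_wrt_nth_less[OF dec, of "i - 1" k] by (cases "k = i - 1") auto
      with k small show False by auto
    qed
  qed
  then have "card {k. k < length xs \<and> c \<le> xs ! k} \<le> i - 1"
    using card_mono[of "{..<i - 1}"] by auto
  moreover have "size (filter_mset (\<lambda>x. c \<le> x) M) = card {k. k < length xs \<and> c \<le> xs ! k}"
    unfolding M[symmetric] by (metis length_filter_conv_card mset_filter size_mset)
  ultimately show False using assms by simp
qed

text \<open>One half of the Courant-Fischer theorem, with a subspace given by homogeneous linear equations
  \<open>cs\<close> instead of a basis. If fewer than \<open>i\<close> eigenvalues were at least \<open>b\<close>, then \<open>cs\<close> together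
  with orthogonality to their eigenvectors would be fewer than \<open>n\<close> equations. A nontrivial solution
  \<open>x\<close> is a combination of eigenvectors with eigenvalues below \<open>b\<close>, so \<open>x \<bullet> A x < b (x \<bullet> x)\<close>,
  contrary to the bound that holds on the subspace.\<close>

lemma nth_largest_eigenvalue_ge:
  fixes A :: "real mat"
  assumes A: "A \<in> carrier_mat n n" "transpose_mat A = A"
    and cs: "set cs \<subseteq> carrier_vec n"
    and form: "\<And>x. x \<in> carrier_vec n \<Longrightarrow> (\<And>c. c \<in> set cs \<Longrightarrow> c \<bullet> x = 0) \<Longrightarrow> b * (x \<bullet> x) \<le> x \<bullet> (A *\<^sub>v x)"
    and i: "1 \<le> i" "i + length cs \<le> n"
  shows "b \<le> nth_largest (proots (char_poly A)) i"
proof -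
  obtain U e where U: "U \<in> carrier_mat n n" "transpose_mat U * U = 1\<^sub>m n"
    and AU: "A = U * mat_diag n e * transpose_mat U"
    using real_symmetric_diagonalization[OF A] by auto
  have Ut: "transpose_mat U \<in> carrier_mat n n" using U by simp
  have UU: "U * transpose_mat U = 1\<^sub>m n" using mat_mult_left_right_inverse[OF Ut U(1,2)] .
  have D: "mat_diag n e \<in> carrier_mat n n" by simp
  have "similar_mat A (mat_diag n e)"
    unfolding similar_mat_def using similar_mat_witI[OF UU U(2) AU A(1) D U(1) Ut] by blast
  then have roots: "proots (char_poly A) = mset (map e [0..<n])"
    using char_poly_similar proots_char_poly_mat_diag by metis
  define K where "K = filter (\<lambda>k. b \<le> e k) [0..<n]"
  have size: "size (filter_mset (\<lambda>x. b \<le> x) (proots (char_poly A))) = length K"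
    unfolding roots K_def by (simp add: mset_filter[symmetric] filter_map o_def del: mset_map mset_filter)
  show ?thesis
  proof (rule ccontr)
    assume "\<not> ?thesis"
    then have "length K < i" using le_nth_largest[OF i(1), of b] size by force
    then have "length (map (col U) K @ cs) < n" using i by simp
    moreover have "set (map (col U) K @ cs) \<subseteq> carrier_vec n" using cs U by auto
    ultimately obtain x where x: "x \<in> carrier_vec n" "x \<noteq> 0\<^sub>v n"
      and orth: "\<And>c. c \<in> set (map (col U) K @ cs) \<Longrightarrow> c \<bullet> x = 0"
      using homogeneous_system_nontrivial_solution by blast
    \<comment> \<open>The coordinates of \<open>x\<close> in the basis of eigenvectors.\<close>
    define y where "y = transpose_mat U *\<^sub>v x"
    have y: "y \<in> carrier_vec n" using Ut x unfolding y_def by simp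
    have Uy: "U *\<^sub>v y = x" unfolding y_def
      using assoc_mult_mat_vec[OF U(1) Ut x(1)] UU x(1) by simp
    have xUz: "x \<bullet> (U *\<^sub>v z) = y \<bullet> z" if "z \<in> carrier_vec n" for z
      unfolding y_def using transpose_vec_mult_scalar[OF U(1) that x(1)] by simp
    have xx: "x \<bullet> x = (\<Sum>k<n. y $ k * y $ k)"
      using xUz[OF y] y unfolding Uy by (simp add: scalar_prod_def lessThan_atLeast0)
    have Dy: "(mat_diag n e *\<^sub>v y) $ k = e k * y $ k" if "k < n" for k
    proof -
      have "(mat_diag n e *\<^sub>v y) $ k = (\<Sum>l<n. (if k = l then e l else 0) * y $ l)"
        using that y by (simp add: mat_diag_def scalar_prod_def lessThan_atLeast0)
      also have "\<dots> = (\<Sum>l<n. if l = k then e k * y $ k else 0)" by (intro sum.cong) auto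
      finally have "(mat_diag n e *\<^sub>v y) $ k = (\<Sum>l<n. if l = k then e k * y $ k else 0)" .
      then show ?thesis using that by simp
    qed
    have "A *\<^sub>v x = U *\<^sub>v (mat_diag n e *\<^sub>v y)"
      unfolding AU y_def using U Ut D x by (simp add: assoc_mult_mat_vec[of _ n n _ n])
    then have "x \<bullet> (A *\<^sub>v x) = y \<bullet> (mat_diag n e *\<^sub>v y)"
      using xUz D y by (metis mult_mat_vec_carrier)
    then have xAx: "x \<bullet> (A *\<^sub>v x) = (\<Sum>k<n. e k * (y $ k * y $ k))"
      using y Dy by (simp add: scalar_prod_def lessThan_atLeast0 mat_diag_def algebra_simps)
    have y0: "y $ k = 0" if "k < n" "b \<le> e k" for k
      using orth[of "col U k"] that U by (simp add: y_def K_def)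
    have "y \<noteq> 0\<^sub>v n" using Uy x(2) U by auto
    then obtain k where k: "k < n" "y $ k \<noteq> 0" using y by (metis eq_vecI carrier_vecD index_zero_vec)
    have "(\<Sum>k<n. e k * (y $ k * y $ k)) < (\<Sum>k<n. b * (y $ k * y $ k))"
    proof (rule sum_strict_mono_ex1)
      show "\<forall>k\<in>{..<n}. e k * (y $ k * y $ k) \<le> b * (y $ k * y $ k)"
      proof
        fix k assume "k \<in> {..<n}"
        then show "e k * (y $ k * y $ k) \<le> b * (y $ k * y $ k)"
          using y0[of k] by (cases "b \<le> e k") (auto intro!: mult_right_mono)
      qed
      have "e k < b" using y0[of k] k by force
      then have "e k * (y $ k * y $ k) < b * (y $ k * y $ k)" 
        using k by (intro mult_strict_right_mono) (auto simp: zero_less_mult_iff)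
      then show "\<exists>k\<in>{..<n}. e k * (y $ k * y $ k) < b * (y $ k * y $ k)" using k by auto
    qed simp
    then have "x \<bullet> (A *\<^sub>v x) < b * (x \<bullet> x)" by (simp add: xAx xx sum_distrib_left)
    moreover have "b * (x \<bullet> x) \<le> x \<bullet> (A *\<^sub>v x)" using form x(1) orth by simp
    ultimately show False by simp
  qed
qed

section \<open>Distances in a connected graph\<close>

lemma (in sym_digraph) apath_reverse:
  assumes "apath u p v"
  shows "\<exists>q. apath v q u \<and> length q = length p \<and> awalk_verts v q = rev (awalk_verts u p)"
  using assms
proof (induction p arbitrary: u)
  case Nil
  then show ?case by (auto simp: apath_Nil_iff)
next
  case (Cons e p)
  then have e: "e \<in> arcs G" "tail G e = u" and p: "apath (head G e) p v"
    and u: "u \<notin> set (awalk_verts (head G e) p)" by (auto simp: apath_Cons_iff)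
  from Cons.IH[OF p] obtain q where q: "apath v q (head G e)" "length q = length p"
    "awalk_verts v q = rev (awalk_verts (head G e) p)" by blast
  obtain e' where e': "e' \<in> arcs G" "tail G e' = head G e" "head G e' = u"
    using sym_arcs e unfolding symmetric_conv by metis
  have aw: "awalk v q (head G e)" using q by (simp add: apath_def)
  have "awalk (head G e) [e'] u" using e' by (auto simp: awalk_simps)
  then have aw2: "awalk v (q @ [e']) u" using aw by auto
  have "awalk_verts v (q @ [e']) = awalk_verts v q @ [u]"
    using awalk_verts_append[OF aw2] e' by simp
  also have "\<dots> = rev (awalk_verts u (e # p))" using q e by simp
  finally have av: "awalk_verts v (q @ [e']) = rev (awalk_verts u (e # p))" .
  have "apath v (q @ [e']) u"
    using aw2 Cons.prems unfolding apath_def av by simp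
  with av q(2) show ?case by (metis length_append_singleton length_Cons)
qed

lemma (in sym_digraph) graph_dist_commute: "graph_dist G u v = graph_dist G v u"
  unfolding graph_dist_def by (metis apath_reverse)

text \<open>Reachability ensures that the minimum in the definition of \<open>graph_dist\<close> is attained by a path; a
  path of length 0 has equal ends, and one of length 1 is an arc.\<close>

lemma (in wf_digraph) graph_dist_ge:
  assumes "u \<rightarrow>\<^sup>* v" "u \<noteq> v"
  shows "1 \<le> graph_dist G u v" "(u, v) \<notin> arcs_ends G \<Longrightarrow> 2 \<le> graph_dist G u v"
proof -
  obtain p where "awalk u p v" using assms(1) by (auto simp: reachable_awalk)
  then have "\<exists>k p. apath u p v \<and> length p = k" using apath_awalk_to_apath by blast
  then have "\<exists>p. apath u p v \<and> length p = graph_dist G u v"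
    unfolding graph_dist_def by (rule LeastI_ex)
  then obtain p where p: "apath u p v" "length p = graph_dist G u v" by blast
  show "1 \<le> graph_dist G u v" using p assms(2) by (cases p) (auto simp: apath_Nil_iff)
  show "2 \<le> graph_dist G u v" if "(u, v) \<notin> arcs_ends G"
  proof (rule ccontr)
    assume "\<not> ?thesis"
    with \<open>1 \<le> graph_dist G u v\<close> p(2) have "length p = 1" by simp
    then obtain e where "p = [e]" by (auto simp: length_Suc_conv)
    with p(1) have "e \<in> arcs G" "tail G e = u" "head G e = v"
      by (auto simp: apath_Cons_iff apath_Nil_iff)
    then have "(u, v) \<in> arcs_ends G" by (auto simp: arcs_ends_def arc_to_ends_def)
    with that show False ..
  qed
qed

section \<open>The quadratic form of the distance Laplacian\<close>

lemma sum_sum_square_diff: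
  fixes f :: "'a \<Rightarrow> real"
  assumes "finite S" "sum f S = 0"
  shows "(\<Sum>u\<in>S. \<Sum>v\<in>S. (f u - f v)\<^sup>2) = 2 * card S * (\<Sum>u\<in>S. (f u)\<^sup>2)"
proof -
  have "(\<Sum>v\<in>S. (f u - f v)\<^sup>2) = card S * (f u)\<^sup>2 + (\<Sum>v\<in>S. (f v)\<^sup>2) - 2 * f u * sum f S" for u
    by (simp add: power2_diff sum.distrib sum_subtractf sum_distrib_left)
  then show ?thesis using assms by (simp add: sum.distrib sum_distrib_left[symmetric])
qed

text \<open>The weights dominate \<open>1 + [u and v share a block]\<close> off the diagonal, and diagonal terms vanish.
  Therefore the form is at least the sum of the same form with unit weights on \<open>V\<close> and on each
  block. On a set \<open>S\<close> over which \<open>f\<close> has sum 0, unit weights give \<open>2 |S| (\<Sum>v\<in>S. (f v)\<^sup>2)\<close>. So \<open>V\<close>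
  contributes the summand \<open>card V\<close> of the constant, and the blocks, which carry all of \<open>f\<close>,
  contribute \<open>m\<close>.\<close>

lemma weighted_square_diff_ge:
  fixes f :: "'a \<Rightarrow> real" and d :: "'a \<Rightarrow> 'a \<Rightarrow> real"
  assumes V: "finite V" and P: "\<Union>P \<subseteq> V" "disjoint P"
    and d1: "\<And>u v. u \<in> V \<Longrightarrow> v \<in> V \<Longrightarrow> u \<noteq> v \<Longrightarrow> 1 \<le> d u v"
    and d2: "\<And>A u v. A \<in> P \<Longrightarrow> u \<in> A \<Longrightarrow> v \<in> A \<Longrightarrow> u \<noteq> v \<Longrightarrow> 2 \<le> d u v"
    and m: "\<And>A. A \<in> P \<Longrightarrow> m \<le> card A"
    and f0: "\<And>v. v \<in> V - \<Union>P \<Longrightarrow> f v = 0"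
    and fA: "\<And>A. A \<in> P \<Longrightarrow> sum f A = 0"
  shows "2 * real (card V + m) * (\<Sum>v\<in>V. (f v)\<^sup>2) \<le> (\<Sum>u\<in>V. \<Sum>v\<in>V. d u v * (f u - f v)\<^sup>2)"
proof -
  have finP: "finite P" using V P(1) by (meson finite_UnionD finite_subset)
  have finA: "finite A" if "A \<in> P" for A using V P(1) that by (meson Sup_le_iff finite_subset)
  have sumP: "sum g V = (\<Sum>A\<in>P. sum g A)" if "\<And>v. v \<in> V - \<Union>P \<Longrightarrow> g v = 0" for g :: "'a \<Rightarrow> real"
  proof -
    have "sum g V = sum g (\<Union>P)" using V P(1) that by (intro sum.mono_neutral_right) auto
    also have "\<dots> = (\<Sum>A\<in>P. sum g A)"
      using sum.Union_disjoint[of P g] finA P(2) by (auto simp: disjoint_def)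
    finally show ?thesis .
  qed
  have fV: "sum f V = 0" using sumP[of f] f0 fA by simp
  have pw: "(f u - f v)\<^sup>2 + (\<Sum>A\<in>P. if u \<in> A \<and> v \<in> A then (f u - f v)\<^sup>2 else 0) \<le> d u v * (f u - f v)\<^sup>2"
    if uv: "u \<in> V" "v \<in> V" for u v
  proof (cases "u = v")
    case False
    show ?thesis
    proof (cases "\<exists>A\<in>P. u \<in> A \<and> v \<in> A")
      case True
      then obtain B where B: "B \<in> P" "u \<in> B" "v \<in> B" by auto
      have "(\<Sum>A\<in>P. if u \<in> A \<and> v \<in> A then (f u - f v)\<^sup>2 else 0) = (\<Sum>A\<in>P. if A = B then (f u - f v)\<^sup>2 else 0)"
        using B P(2) by (intro sum.cong) (auto simp: disjoint_def)
      then show ?thesis using B finP d2[OF B False] mult_right_mono[of 2 "d u v" "(f u - f v)\<^sup>2"] by simp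
    next
      case no_class: False
      then have "(\<Sum>A\<in>P. if u \<in> A \<and> v \<in> A then (f u - f v)\<^sup>2 else 0) = 0" by (intro sum.neutral) auto
      then show ?thesis using d1[OF uv False] mult_right_mono[of 1 "d u v" "(f u - f v)\<^sup>2"] by simp
    qed
  qed (simp cong: if_cong)
  have block: "(\<Sum>u\<in>V. \<Sum>v\<in>V. if u \<in> A \<and> v \<in> A then (f u - f v)\<^sup>2 else 0) = 2 * card A * (\<Sum>u\<in>A. (f u)\<^sup>2)"
    if "A \<in> P" for A
  proof -
    have AV: "V \<inter> A = A" using that P(1) by auto
    have "(\<Sum>u\<in>V. \<Sum>v\<in>V. if u \<in> A \<and> v \<in> A then (f u - f v)\<^sup>2 else 0) =
      (\<Sum>u\<in>V. if u \<in> A then \<Sum>v\<in>V. if v \<in> A then (f u - f v)\<^sup>2 else 0 else 0)"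
      by (intro sum.cong) auto
    also have "\<dots> = (\<Sum>u\<in>A. \<Sum>v\<in>A. (f u - f v)\<^sup>2)"
      using V by (simp add: sum.inter_restrict[symmetric] AV)
    finally show ?thesis using sum_sum_square_diff[OF finA[OF that] fA[OF that]] by simp
  qed
  have "2 * real (card V + m) * (\<Sum>v\<in>V. (f v)\<^sup>2) =
      2 * card V * (\<Sum>v\<in>V. (f v)\<^sup>2) + (\<Sum>A\<in>P. 2 * real m * (\<Sum>v\<in>A. (f v)\<^sup>2))"
    using sumP[of "\<lambda>v. (f v)\<^sup>2"] f0 by (simp add: sum_distrib_left algebra_simps)
  also have "\<dots> \<le> 2 * card V * (\<Sum>v\<in>V. (f v)\<^sup>2) + (\<Sum>A\<in>P. 2 * real (card A) * (\<Sum>v\<in>A. (f v)\<^sup>2))"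
    using m by (intro add_left_mono sum_mono mult_right_mono sum_nonneg) auto
  also have "\<dots> = (\<Sum>u\<in>V. \<Sum>v\<in>V. (f u - f v)\<^sup>2) +
      (\<Sum>A\<in>P. \<Sum>u\<in>V. \<Sum>v\<in>V. if u \<in> A \<and> v \<in> A then (f u - f v)\<^sup>2 else 0)"
    using sum_sum_square_diff[OF V fV] block by simp
  also have "(\<Sum>A\<in>P. \<Sum>u\<in>V. \<Sum>v\<in>V. if u \<in> A \<and> v \<in> A then (f u - f v)\<^sup>2 else 0) =
      (\<Sum>u\<in>V. \<Sum>v\<in>V. \<Sum>A\<in>P. if u \<in> A \<and> v \<in> A then (f u - f v)\<^sup>2 else 0)"
    by (subst sum.swap, intro sum.cong refl, subst sum.swap, rule refl)
  also have "(\<Sum>u\<in>V. \<Sum>v\<in>V. (f u - f v)\<^sup>2) + \<dots> =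
      (\<Sum>u\<in>V. \<Sum>v\<in>V. (f u - f v)\<^sup>2 + (\<Sum>A\<in>P. if u \<in> A \<and> v \<in> A then (f u - f v)\<^sup>2 else 0))"
    by (simp add: sum.distrib)
  also have "\<dots> \<le> (\<Sum>u\<in>V. \<Sum>v\<in>V. d u v * (f u - f v)\<^sup>2)" by (intro sum_mono pw)
  finally show ?thesis .
qed

lemma weighted_laplacian_form:
  fixes f :: "'a \<Rightarrow> real"
  assumes "\<And>u v. u \<in> V \<Longrightarrow> v \<in> V \<Longrightarrow> d u v = d v u"
  shows "2 * (\<Sum>u\<in>V. f u * ((\<Sum>v\<in>V. d u v) * f u - (\<Sum>v\<in>V. d u v * f v))) =
    (\<Sum>u\<in>V. \<Sum>v\<in>V. d u v * (f u - f v)\<^sup>2)"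
proof -
  have "(\<Sum>u\<in>V. \<Sum>v\<in>V. d u v * (f v)\<^sup>2) = (\<Sum>v\<in>V. \<Sum>u\<in>V. d u v * (f v)\<^sup>2)" by (rule sum.swap)
  also have "\<dots> = (\<Sum>u\<in>V. \<Sum>v\<in>V. d u v * (f u)\<^sup>2)" using assms by (intro sum.cong) auto
  finally have "(\<Sum>u\<in>V. \<Sum>v\<in>V. d u v * (f u - f v)\<^sup>2) =
     2 * (\<Sum>u\<in>V. \<Sum>v\<in>V. d u v * (f u)\<^sup>2) - 2 * (\<Sum>u\<in>V. \<Sum>v\<in>V. d u v * (f u * f v))"
    by (simp add: power2_diff algebra_simps sum.distrib sum_subtractf sum_distrib_left)
  then show ?thesis
    by (simp add: power2_eq_square algebra_simps sum_subtractf sum_distrib_left sum_distrib_right)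
qed

text \<open>Turns the sizes \<open>class_size C j\<close> into the sizes of actual classes: listing the elements of \<open>C\<close> by
  decreasing \<open>g\<close> makes the \<open>j\<close>-th largest value the value at the \<open>j\<close>-th element.\<close>

lemma nth_largest_image_mset:
  fixes g :: "'a \<Rightarrow> 'b :: linorder"
  assumes "finite C"
  obtains xs where "distinct xs" "set xs = C" "sorted_wrt (\<lambda>x y. g x \<ge> g y) xs"
    "\<And>j. 1 \<le> j \<Longrightarrow> j \<le> card C \<Longrightarrow> nth_largest (image_mset g (mset_set C)) j = g (xs ! (j - 1))"
proof -
  obtain ys where ys: "set ys = C" "distinct ys" using finite_distinct_list[OF assms] by blast
  define xs where "xs = rev (sort_key g ys)"
  have "mset_set C = mset (sort_key g ys)" using ys by (metis mset_set_set mset_sort)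
  then have "sorted_list_of_multiset (image_mset g (mset_set C)) = map g (sort_key g ys)"
    by (metis mset_map sorted_list_of_multiset_mset sorted_sort_id sorted_sort_key)
  then have "nth_largest (image_mset g (mset_set C)) j = g (xs ! (j - 1))" if "1 \<le> j" "j \<le> card C" for j
    using that ys by (simp add: nth_largest_def xs_def rev_map distinct_card[symmetric])
  moreover have "sorted_wrt (\<lambda>x y. g x \<ge> g y) xs"
    using sorted_sort_key[of g ys] by (simp add: xs_def sorted_wrt_rev sorted_map)
  ultimately show ?thesis using that[of xs] ys by (simp add: xs_def)
qed

section \<open>Eigenvalue bounds from colour classes\<close>

text \<open>The Courant-Fischer bound in terms of functions on the vertices instead of coordinate vectors. All
  equations that are needed say that \<open>f\<close> has sum 0 over some set of vertices, where a singleton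
  expresses that \<open>f\<close> vanishes at a vertex.\<close>

lemma dl_eigenvalue_ge:
  assumes "graph G" and vs: "distinct vs" "set vs = verts G"
    and Ss: "\<And>S. S \<in> set Ss \<Longrightarrow> S \<subseteq> verts G"
    and form: "\<And>f :: 'a \<Rightarrow> real. (\<And>S. S \<in> set Ss \<Longrightarrow> sum f S = 0) \<Longrightarrow>
      2 * b * (\<Sum>v\<in>verts G. (f v)\<^sup>2) \<le>
        (\<Sum>u\<in>verts G. \<Sum>v\<in>verts G. real (graph_dist G u v) * (f u - f v)\<^sup>2)"
    and i: "1 \<le> i" "i + length Ss \<le> card (verts G)"
  shows "b \<le> dl_eigenvalue G vs i"
proof -
  interpret graph G by fact
  define n where "n = length vs"
  have n: "n = card (verts G)" using vs distinct_card n_def by metis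
  define d where "d = (\<lambda>u v. real (graph_dist G u v))"
  have dsym: "d u v = d v u" for u v unfolding d_def using graph_dist_commute by metis
  have bij: "bij_betw ((!) vs) {..<n} (verts G)"
    using bij_betw_nth[OF vs(1)] vs(2) n_def by auto
  have reindex: "(\<Sum>k<n. g (vs ! k)) = sum g (verts G)" for g :: "'a \<Rightarrow> real"
    by (rule sum.reindex_bij_betw[OF bij])
  let ?L = "distance_laplacian G vs"
  have L: "?L \<in> carrier_mat n n"
    unfolding distance_laplacian_def distance_matrix_def n_def by (intro minus_carrier_mat) simp
  have Lent: "?L $$ (k, l) = (if k = l then (\<Sum>v\<in>verts G. d (vs ! k) v) else 0) - d (vs ! k) (vs ! l)"
    if "k < n" "l < n" for k l
    using that dsym by (simp add: distance_laplacian_def distance_matrix_def mat_diag_def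
        n_def transmission_def d_def)
  have Lsym: "transpose_mat ?L = ?L"
    by (rule eq_matI) (use L Lent dsym in auto)
  define ind where "ind = (\<lambda>S. vec n (\<lambda>k. if vs ! k \<in> S then 1 else 0 :: real))"
  have "b \<le> nth_largest (proots (char_poly ?L)) i"
  proof (rule nth_largest_eigenvalue_ge[OF L Lsym, where cs = "map ind Ss"])
    show "set (map ind Ss) \<subseteq> carrier_vec n" by (auto simp: ind_def)
    show "1 \<le> i" "i + length (map ind Ss) \<le> n" using i n by auto
    fix x assume x: "x \<in> carrier_vec n" and orth: "\<And>c. c \<in> set (map ind Ss) \<Longrightarrow> c \<bullet> x = 0"
    define f where "f = (\<lambda>v. x $ the_inv_into {..<n} ((!) vs) v)"
    have f: "x $ k = f (vs ! k)" if "k < n" for k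
      using that bij unfolding f_def by (simp add: the_inv_into_f_f bij_betw_def)
    have "sum f S = 0" if S: "S \<in> set Ss" for S
    proof -
      have "0 = ind S \<bullet> x" using orth S by simp
      also have "\<dots> = (\<Sum>k<n. if vs ! k \<in> S then f (vs ! k) else 0)"
        using x f by (auto simp: ind_def scalar_prod_def lessThan_atLeast0 intro!: sum.cong)
      also have "\<dots> = (\<Sum>v\<in>verts G. if v \<in> S then f v else 0)" by (rule reindex)
      also have "\<dots> = sum f S"
        using Ss[OF S] by (simp add: sum.inter_restrict[symmetric] Int_absorb1)
      finally show ?thesis by simp
    qed
    from form[OF this] have form_f: "2 * b * (\<Sum>v\<in>verts G. (f v)\<^sup>2) \<le>
        (\<Sum>u\<in>verts G. \<Sum>v\<in>verts G. d u v * (f u - f v)\<^sup>2)" by (simp add: d_def)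
    have "x \<bullet> x = (\<Sum>k<n. (f (vs ! k))\<^sup>2)"
      using x f by (simp add: scalar_prod_def lessThan_atLeast0 power2_eq_square)
    then have xx: "x \<bullet> x = (\<Sum>v\<in>verts G. (f v)\<^sup>2)" using reindex[of "\<lambda>v. (f v)\<^sup>2"] by simp
    have Lx: "(?L *\<^sub>v x) $ k = (\<Sum>v\<in>verts G. d (vs ! k) v) * f (vs ! k) - (\<Sum>v\<in>verts G. d (vs ! k) v * f v)"
      if k: "k < n" for k
    proof -
      have "(?L *\<^sub>v x) $ k = (\<Sum>l<n. ?L $$ (k, l) * f (vs ! l))"
        using k x L f by (simp add: scalar_prod_def lessThan_atLeast0)
      also have "\<dots> = (\<Sum>l<n. (if l = k then (\<Sum>v\<in>verts G. d (vs ! k) v) * f (vs ! k) else 0)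
          - d (vs ! k) (vs ! l) * f (vs ! l))"
        using k by (intro sum.cong) (auto simp: Lent algebra_simps)
      also have "\<dots> = (\<Sum>v\<in>verts G. d (vs ! k) v) * f (vs ! k) - (\<Sum>l<n. d (vs ! k) (vs ! l) * f (vs ! l))"
        using k by (simp add: sum_subtractf)
      also have "(\<Sum>l<n. d (vs ! k) (vs ! l) * f (vs ! l)) = (\<Sum>v\<in>verts G. d (vs ! k) v * f v)"
        by (rule reindex)
      finally show ?thesis .
    qed
    have "x \<bullet> (?L *\<^sub>v x) = (\<Sum>k<n. f (vs ! k) *
        ((\<Sum>v\<in>verts G. d (vs ! k) v) * f (vs ! k) - (\<Sum>v\<in>verts G. d (vs ! k) v * f v)))"
      using x L f Lx by (simp add: scalar_prod_def lessThan_atLeast0)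
    also have "\<dots> = (\<Sum>u\<in>verts G. f u * ((\<Sum>v\<in>verts G. d u v) * f u - (\<Sum>v\<in>verts G. d u v * f v)))"
      by (rule reindex)
    finally have "2 * (x \<bullet> (?L *\<^sub>v x)) = (\<Sum>u\<in>verts G. \<Sum>v\<in>verts G. d u v * (f u - f v)\<^sup>2)"
      using weighted_laplacian_form[of "verts G" d f] dsym by simp
    with form_f xx show "b * (x \<bullet> x) \<le> x \<bullet> (?L *\<^sub>v x)" by simp
  qed
  then show ?thesis by (simp add: dl_eigenvalue_def)
qed

text \<open>The list \<open>Ss\<close> below describes the space \<open>W\<close> of functions that vanish outside the \<open>j\<close> largest
  classes \<open>P\<close> and have sum 0 on each of them: one equation for every vertex outside and one for every
  class. Since the classes in \<open>P\<close> cover \<open>(\<Sum>t = 1..j. class_size C t - 1) + j\<close> vertices, the number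
  of equations leaves room for exactly the indices \<open>i\<close> in question.\<close>

lemma dl_eigenvalue_ge_class_size:
  assumes "graph G" and conn: "Digraph_Component.connected G"
    and vs: "distinct vs" "set vs = verts G" and col: "proper_coloring G C"
    and j: "1 \<le> j" "j \<le> card C" and i: "1 \<le> i" "i \<le> (\<Sum>t = 1..j. (class_size C t - 1))"
  shows "real (card (verts G) + class_size C j) \<le> dl_eigenvalue G vs i"
proof -
  interpret graph G by fact
  have C: "\<Union>C = verts G" "disjoint C" "{} \<notin> C" and ind: "\<And>A. A \<in> C \<Longrightarrow> independent_set G A"
    using col by (auto simp: proper_coloring_def partition_on_def)
  have finC: "finite C" using C(1) finite_verts by (metis finite_UnionD)
  have finA: "finite A" "card A \<ge> 1" if "A \<in> C" for A
  proof -
    show "finite A" using that C(1) finite_verts by (metis Sup_upper finite_subset)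
    then show "card A \<ge> 1" using that C(3) by (metis One_nat_def Suc_leI card_gt_0_iff)
  qed
  obtain xs where xs: "distinct xs" "set xs = C" "sorted_wrt (\<lambda>x y. card x \<ge> card y) xs"
    and size: "\<And>t. 1 \<le> t \<Longrightarrow> t \<le> card C \<Longrightarrow> class_size C t = card (xs ! (t - 1))"
    using nth_largest_image_mset[OF finC, of card] unfolding class_size_def by metis
  have len: "length xs = card C" using xs distinct_card by metis
  define P where "P = set (take j xs)"
  have PC: "P \<subseteq> C" using xs(2) set_take_subset unfolding P_def by metis
  have cardP: "card P = j"
    unfolding P_def using xs(1) len j by (simp add: distinct_card)
  have disjP: "disjoint P" using C(2) PC by (meson disjoint_def subsetD)
  have PV: "\<Union>P \<subseteq> verts G" using PC C(1) by auto
  have big: "class_size C j \<le> card A" if "A \<in> P" for A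
  proof -
    from that obtain k where k: "k < j" "A = xs ! k"
      unfolding P_def using j len by (auto simp: in_set_conv_nth)
    then have "card (xs ! (j - 1)) \<le> card (xs ! k)"
      using sorted_wrt_nth_less[OF xs(3), of k "j - 1"] j len by (cases "k = j - 1") auto
    then show ?thesis using size j k by simp
  qed
  have "card (\<Union>P) = (\<Sum>A\<in>P. card A)"
    by (rule card_Union_disjoint[OF disjP]) (use finA PC in auto)
  also have "\<dots> = (\<Sum>A\<in>P. card A - 1) + card P"
  proof -
    have "(\<Sum>A\<in>P. card A) = (\<Sum>A\<in>P. (card A - 1) + 1)"
    proof (intro sum.cong refl)
      show "card A = (card A - 1) + 1" if "A \<in> P" for A using finA(2)[of A] that PC by auto
    qed
    then show ?thesis unfolding sum.distrib by simp
  qed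
  also have "(\<Sum>A\<in>P. card A - 1) = (\<Sum>k<j. card (xs ! k) - 1)"
  proof -
    have "bij_betw ((!) (take j xs)) {..<j} P"
      unfolding P_def using bij_betw_nth[of "take j xs" "{..<j}"] xs(1) j len by simp
    from sum.reindex_bij_betw[OF this, of "\<lambda>A. card A - 1"] show ?thesis by simp
  qed
  also have "\<dots> = (\<Sum>t = 1..j. class_size C t - 1)"
    using j size by (intro sum.reindex_bij_witness[of _ "\<lambda>t. t - 1" Suc]) auto
  finally have cardUP: "card (\<Union>P) = (\<Sum>t = 1..j. class_size C t - 1) + j" using cardP by simp
  define Ss where "Ss = map (\<lambda>v. {v}) (filter (\<lambda>v. v \<notin> \<Union>P) vs) @ take j xs"
  have Ss: "set Ss = (\<lambda>v. {v}) ` (verts G - \<Union>P) \<union> P"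
    unfolding Ss_def P_def using vs(2) by auto
  have "length (filter (\<lambda>v. v \<notin> \<Union>P) vs) = card (verts G - \<Union>P)"
    using vs distinct_card[of "filter (\<lambda>v. v \<notin> \<Union>P) vs"] by (simp add: set_diff_eq)
  also have "\<dots> = card (verts G) - card (\<Union>P)"
    using PV by (meson card_Diff_subset finite_subset finite_verts)
  finally have "length Ss = card (verts G) - card (\<Union>P) + j"
    unfolding Ss_def using j len by simp
  moreover have "card (\<Union>P) \<le> card (verts G)" using PV by (simp add: card_mono)
  ultimately have dim: "i + length Ss \<le> card (verts G)" using i cardUP by linarith
  have reach: "u \<rightarrow>\<^sup>*\<^bsub>G\<^esub> v" if "u \<in> verts G" "v \<in> verts G" for u v
    using symmetric_connected_imp_strongly_connected[OF sym_arcs conn] that by auto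
  show ?thesis
  proof (rule dl_eigenvalue_ge[OF \<open>graph G\<close> vs _ _ i(1) dim])
    show "S \<subseteq> verts G" if "S \<in> set Ss" for S using that Ss PV by auto
    fix f :: "'a \<Rightarrow> real" assume f: "\<And>S. S \<in> set Ss \<Longrightarrow> sum f S = 0"
    show "2 * real (card (verts G) + class_size C j) * (\<Sum>v\<in>verts G. (f v)\<^sup>2) \<le>
        (\<Sum>u\<in>verts G. \<Sum>v\<in>verts G. real (graph_dist G u v) * (f u - f v)\<^sup>2)"
    proof (rule weighted_square_diff_ge[OF finite_verts PV disjP])
      show "1 \<le> real (graph_dist G u v)" if "u \<in> verts G" "v \<in> verts G" "u \<noteq> v" for u v
        using graph_dist_ge(1)[OF reach] that by simp
      show "2 \<le> real (graph_dist G u v)" if "A \<in> P" "u \<in> A" "v \<in> A" "u \<noteq> v" for A u v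
      proof -
        have "u \<in> verts G" "v \<in> verts G" "(u, v) \<notin> arcs_ends G"
          using that PC ind[of A] by (auto simp: independent_set_def)
        then show ?thesis using graph_dist_ge(2)[OF reach] that(4) by simp
      qed
      show "f v = 0" if "v \<in> verts G - \<Union>P" for v using f[of "{v}"] that Ss by auto
      show "sum f A = 0" if "A \<in> P" for A using f that Ss by simp
    qed (rule big)
  qed
qed

theorem theorem3p1:
  fixes G :: "('a, 'b) pre_digraph" and vs :: "'a list" and C :: "'a set set"
    and n \<chi> p :: nat and l s :: "nat \<Rightarrow> nat"
  assumes "graph G" and "Digraph_Component.connected G"
    and "distinct vs" and "set vs = verts G"
    and "n = card (verts G)"
    and "\<chi> = chromatic_number G"
    and "proper_coloring G C" and "card C = \<chi>"
    and "l = class_size C"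
    and "s = (\<lambda>j. \<Sum>t = 1..j. (l t - 1))"
    and "p = card {j \<in> {1..\<chi>}. l j \<ge> 2}"
  shows "(\<forall>i. 1 \<le> i \<and> i \<le> l 1 - 1 \<longrightarrow> dl_eigenvalue G vs i \<ge> real (n + l 1)) \<and>
    (\<forall>j i. 1 \<le> j \<and> j \<le> p \<and> s (j - 1) + 1 \<le> i \<and> i \<le> s j \<longrightarrow>
       dl_eigenvalue G vs i \<ge> real (n + l j))"
proof -
  have bound: "real (n + l j) \<le> dl_eigenvalue G vs i"
    if "1 \<le> j" "j \<le> card C" "1 \<le> i" "i \<le> s j" for i j
    using dl_eigenvalue_ge_class_size[OF assms(1-4,7)] that assms by simp
  interpret graph G by fact
  have "verts G \<noteq> {}"
    using symmetric_connected_imp_strongly_connected[OF sym_arcs assms(2)]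
    by (simp add: strongly_connected_def)
  moreover have "\<Union>C = verts G" using assms(7) by (simp add: proper_coloring_def partition_on_def)
  ultimately have "card C \<ge> 1"
    using finite_verts by (metis One_nat_def Sup_empty Suc_leI card_gt_0_iff finite_UnionD)
  moreover have "s 1 = l 1 - 1" by (simp add: assms(10))
  moreover have "p \<le> card C"
  proof -
    have "{j \<in> {1..\<chi>}. l j \<ge> 2} \<subseteq> {1..\<chi>}" by auto
    from card_mono[OF _ this] show ?thesis using assms(8,11) by simp
  qed
  ultimately show ?thesis using bound by (metis add_leD2 le_refl le_trans)
qed

end
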